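(* Consider the lattice $x(s)=4\beta s^2+\mathfrak{c}_5s$ with $\beta,\mathfrak{c}_5\in\mathbb{C}$, $(\beta,\mathfrak{c}_5)\neq(0,0)$. Let $(P_n)_{n\ge0}$ be a monic OPS with respect to ${\bf u}\in\mathcal{P}^*$, with recurrence coefficients $B_n$, $C_n$, satisfying $$(z+c)\,\mathrm{D}_xP_n(z)=b_n\,\mathrm{S}_xP_n(z)+c_n\,\mathrm{S}_xP_{n-1}(z),\qquad n=0,1,\ldots,$$ for some complex sequences $b_n$, $c_n$ with $c_n\neq0$ for $n=1,2,\ldots$, where the constant $c\in\mathbb{C}$ is such that $$2\big(C_2+(B_0-B_1)c\big)=(B_1-5\beta)^2-(B_0-5\beta)^2.$$ Then, up to an affine transformation of the variable, $P_n$ is one of the following specific cases of the monic continuous dual Hahn polynomials $H_n$: either there are complex numbers $a,b$ such that, for each $n=0,1,\ldots$, $$P_n(z)=(-4\beta)^nH_n\left(-\frac{1}{4\beta}\Big(z+\frac{\mathfrak{c}_5^2}{16\beta}\Big);a,b,\frac12\right),$$ or, for each $n=0,1,\ldots$, $$P_n(z)=(-4\beta)^nH_n\left(-\frac{1}{4\beta}\Big(z+2\beta+\frac{\mathfrak{c}_5^2}{16\beta}\Big);d-\frac12,e-\frac12,\frac12\right),$$ where $d$ and $e$ are complex numbers such that $-d\notin\mathbb{N}_0$ and $$e:=-1+\frac{1}{1+d}\left(1-\frac{\mathfrak{c}_5^2}{64\beta^2}\right).$$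
   Context: $\mathcal{P}$ is the vector space of polynomials with complex coefficients, $\mathcal{P}^*$ its algebraic dual, $\mathbb{N}_0=\{0,1,2,\ldots\}$. A sequence $(P_n)_{n\ge0}$ with $\deg P_n=n$ is an orthogonal polynomial sequence (OPS) with respect to ${\bf u}\in\mathcal{P}^*$ if $\langle{\bf u},P_nP_m\rangle=h_n\delta_{n,m}$ with $h_n\ne0$. A monic OPS satisfies a three-term recurrence $P_{-1}=0$, $P_0=1$, $P_{n+1}(z)=(z-B_n)P_n(z)-C_nP_{n-1}(z)$ with $C_n\neq0$; the $B_n$ ($n\ge 0$) and $C_n$ ($n\ge1$) are its recurrence coefficients. The operators on polynomials are defined by $$\mathrm{D}_xf(x(s))=\frac{f(x(s+\tfrac12))-f(x(s-\tfrac12))}{x(s+\tfrac12)-x(s-\tfrac12)},\qquad \mathrm{S}_xf(x(s))=\frac{f(x(s+\tfrac12))+f(x(s-\tfrac12))}{2}.$$ The monic continuous dual Hahn polynomials $H_n(\cdot;t_1,t_2,t_3)$ are the monic polynomials satisfying the three-term recurrence above with $$B_n=(n+t_1+t_2)(n+t_1+t_3)+n(n+t_2+t_3-1)-t_1^2,$$ $$C_{n+1}=(n+1)(n+t_1+t_2)(n+t_1+t_3)(n+t_2+t_3),\qquad n=0,1,\ldots,$$ with the restrictions $-t_1-t_2,\,-t_1-t_3,\,-t_2-t_3\notin\mathbb{N}_0$. *)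

theory Defs
  imports Complex_Main "HOL-Computational_Algebra.Polynomial"
begin

definition algebraic_dual :: "(complex poly \<Rightarrow> complex) set" where
  "algebraic_dual = {u. Vector_Spaces.linear smult (*) u}"

text \<open>Sequences are indexed by the natural numbers; \<open>prev P n\<close> is the member of index
  \<open>n - 1\<close>, with the convention that the member of index \<open>-1\<close> is the zero polynomial.\<close>

definition prev :: "(nat \<Rightarrow> complex poly) \<Rightarrow> nat \<Rightarrow> complex poly" where
  "prev P n = (case n of 0 \<Rightarrow> 0 | Suc m \<Rightarrow> P m)"

definition is_OPS :: "(complex poly \<Rightarrow> complex) \<Rightarrow> (nat \<Rightarrow> complex poly) \<Rightarrow> bool" where
  "is_OPS u P \<longleftrightarrow> (\<forall>n. degree (P n) = n) \<and>
     (\<exists>h. (\<forall>n. h n \<noteq> 0) \<and> (\<forall>n m. u (P n * P m) = (if n = m then h n else 0)))"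

definition is_monic_OPS :: "(complex poly \<Rightarrow> complex) \<Rightarrow> (nat \<Rightarrow> complex poly) \<Rightarrow> bool" where
  "is_monic_OPS u P \<longleftrightarrow> is_OPS u P \<and> (\<forall>n. lead_coeff (P n) = 1)"

text \<open>The value \<open>C 0\<close> is irrelevant, since it is multiplied by the zero polynomial.\<close>

definition recurrence_coeffs ::
  "(nat \<Rightarrow> complex poly) \<Rightarrow> (nat \<Rightarrow> complex) \<Rightarrow> (nat \<Rightarrow> complex) \<Rightarrow> bool" where
  "recurrence_coeffs P B C \<longleftrightarrow> P 0 = 1 \<and>
     (\<forall>n. P (Suc n) = [:- B n, 1:] * P n - smult (C n) (prev P n)) \<and>
     (\<forall>n\<ge>1. C n \<noteq> 0)"

definition quadratic_lattice :: "complex \<Rightarrow> complex \<Rightarrow> complex \<Rightarrow> complex" where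
  "quadratic_lattice \<beta> c5 s = 4 * \<beta> * s\<^sup>2 + c5 * s"

text \<open>\<open>Dx x f\<close> and \<open>Sx x f\<close> are the polynomials whose values on the lattice are the
  quotient and the mean in the definitions below. The quotient is only required where its
  denominator does not vanish (for \<open>x = quadratic_lattice \<beta> c5\<close>, everywhere except possibly
  at a single point). Existence and uniqueness are the lemmas \<open>Dx_eqI\<close>, \<open>Sx_eqI\<close>,
  \<open>Dx_lattice\<close> and \<open>Sx_lattice\<close>.\<close>

definition Dx :: "(complex \<Rightarrow> complex) \<Rightarrow> complex poly \<Rightarrow> complex poly" where
  "Dx x f = (THE g. \<forall>s. x (s + 1/2) \<noteq> x (s - 1/2) \<longrightarrow>
     poly g (x s) = (poly f (x (s + 1/2)) - poly f (x (s - 1/2))) / (x (s + 1/2) - x (s - 1/2)))"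

definition Sx :: "(complex \<Rightarrow> complex) \<Rightarrow> complex poly \<Rightarrow> complex poly" where
  "Sx x f = (THE g. \<forall>s.
     poly g (x s) = (poly f (x (s + 1/2)) + poly f (x (s - 1/2))) / 2)"

lemma quadratic_lattice_diff:
  "quadratic_lattice \<beta> c5 (s + 1/2) - quadratic_lattice \<beta> c5 (s - 1/2) = 8 * \<beta> * s + c5"
  by (simp add: quadratic_lattice_def power2_eq_square algebra_simps)

lemma finite_lattice_fibre:
  assumes "(\<beta>, c5) \<noteq> (0, 0)"
  shows "finite {s. quadratic_lattice \<beta> c5 s = w}"
proof -
  have "{s. quadratic_lattice \<beta> c5 s = w} = {s. poly [:- w, c5, 4 * \<beta>:] s = 0}"
    by (auto simp: quadratic_lattice_def power2_eq_square algebra_simps)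
  moreover have "[:- w, c5, 4 * \<beta>:] \<noteq> 0"
    using assms by auto
  ultimately show ?thesis
    using poly_roots_finite[of "[:- w, c5, 4 * \<beta>:]"] by metis
qed

lemma infinite_lattice_image:
  assumes "(\<beta>, c5) \<noteq> (0, 0)"
  shows "infinite (quadratic_lattice \<beta> c5 `
    {s. quadratic_lattice \<beta> c5 (s + 1/2) \<noteq> quadratic_lattice \<beta> c5 (s - 1/2)})"
    (is "infinite (?x ` ?A)")
proof
  assume fin: "finite (?x ` ?A)"
  have "finite {s. 8 * \<beta> * s + c5 = 0}"
  proof -
    have "{s. 8 * \<beta> * s + c5 = 0} = {s. poly [:c5, 8 * \<beta>:] s = 0}"
      by (auto simp: algebra_simps)
    moreover have "[:c5, 8 * \<beta>:] \<noteq> 0"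
      using assms by auto
    ultimately show ?thesis
      using poly_roots_finite[of "[:c5, 8 * \<beta>:]"] by metis
  qed
  moreover have "?A = UNIV - {s. 8 * \<beta> * s + c5 = 0}"
    by (auto simp flip: quadratic_lattice_diff)
  moreover have "infinite (UNIV :: complex set)"
    by (rule infinite_UNIV_char_0)
  ultimately have "infinite ?A"
    by (metis Diff_infinite_finite)
  moreover have "?A \<subseteq> (\<Union>w\<in>?x ` ?A. {s. ?x s = w})"
    by auto
  moreover have "finite (\<Union>w\<in>?x ` ?A. {s. ?x s = w})"
    using fin finite_lattice_fibre[OF assms] by blast
  ultimately show False
    using finite_subset by blast
qed

lemma poly_eq_on_infinite:
  fixes p q :: "complex poly"
  assumes "infinite A" "\<And>z. z \<in> A \<Longrightarrow> poly p z = poly q z"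
  shows "p = q"
proof (rule ccontr)
  assume "p \<noteq> q"
  then have "finite {z. poly (p - q) z = 0}"
    by (intro poly_roots_finite) simp
  moreover have "A \<subseteq> {z. poly (p - q) z = 0}"
    using assms(2) by auto
  ultimately show False
    using assms(1) finite_subset by blast
qed

lemma Dx_Sx_exist:
  "\<exists>S D. \<forall>s. let X = quadratic_lattice \<beta> c5 s; Xp = quadratic_lattice \<beta> c5 (s + 1/2);
                Xm = quadratic_lattice \<beta> c5 (s - 1/2) in
      poly f Xp + poly f Xm = 2 * poly S X \<and> poly f Xp - poly f Xm = (Xp - Xm) * poly D X"
proof (induction f)
  case 0
  show ?case by (intro exI[of _ 0]) simp
next
  case (pCons a p)
  then obtain S D where IH: "\<And>s. let X = quadratic_lattice \<beta> c5 s;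
                Xp = quadratic_lattice \<beta> c5 (s + 1/2); Xm = quadratic_lattice \<beta> c5 (s - 1/2) in
      poly p Xp + poly p Xm = 2 * poly S X \<and> poly p Xp - poly p Xm = (Xp - Xm) * poly D X"
    by blast
  show ?case
  proof (intro exI allI)
    fix s
    define X where "X = quadratic_lattice \<beta> c5 s"
    define Xp where "Xp = quadratic_lattice \<beta> c5 (s + 1/2)"
    define Xm where "Xm = quadratic_lattice \<beta> c5 (s - 1/2)"
    have sum: "Xp + Xm = 2 * (X + \<beta>)" and sq: "(Xp - Xm)\<^sup>2 = 4 * (4 * \<beta> * X + c5\<^sup>2 / 4)"
      by (simp_all add: X_def Xp_def Xm_def quadratic_lattice_def power2_eq_square field_simps)
    have 1: "poly p Xp + poly p Xm = 2 * poly S X"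
      and 2: "poly p Xp - poly p Xm = (Xp - Xm) * poly D X"
      using IH[of s] by (simp_all add: X_def Xp_def Xm_def Let_def)
    have pp: "poly p Xp = poly S X + (Xp - Xm) * poly D X / 2"
      and pm: "poly p Xm = poly S X - (Xp - Xm) * poly D X / 2"
      using 1 2 by (simp_all add: field_simps) (algebra+)
    have "poly (pCons a p) Xp + poly (pCons a p) Xm
        = 2 * a + (Xp + Xm) * poly S X + (Xp - Xm)\<^sup>2 * poly D X / 2"
      by (simp add: pp pm power2_eq_square field_simps)
    also have "\<dots> = 2 * poly ([:a:] + [:\<beta>, 1:] * S + [:c5\<^sup>2 / 4, 4 * \<beta>:] * D) X"
      unfolding sum sq by (simp add: algebra_simps)
    finally have A: "poly (pCons a p) Xp + poly (pCons a p) Xm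
        = 2 * poly ([:a:] + [:\<beta>, 1:] * S + [:c5\<^sup>2 / 4, 4 * \<beta>:] * D) X" .
    have "poly (pCons a p) Xp - poly (pCons a p) Xm
        = (Xp - Xm) * (poly S X + (Xp + Xm) * poly D X / 2)"
      by (simp add: pp pm field_simps)
    also have "\<dots> = (Xp - Xm) * poly (S + [:\<beta>, 1:] * D) X"
      unfolding sum by (simp add: field_simps)
    finally have "poly (pCons a p) Xp - poly (pCons a p) Xm
        = (Xp - Xm) * poly (S + [:\<beta>, 1:] * D) X" .
    with A show "let X = quadratic_lattice \<beta> c5 s;
                Xp = quadratic_lattice \<beta> c5 (s + 1/2); Xm = quadratic_lattice \<beta> c5 (s - 1/2) in
      poly (pCons a p) Xp + poly (pCons a p) Xm
        = 2 * poly ([:a:] + [:\<beta>, 1:] * S + [:c5\<^sup>2 / 4, 4 * \<beta>:] * D) X \<and>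
      poly (pCons a p) Xp - poly (pCons a p) Xm = (Xp - Xm) * poly (S + [:\<beta>, 1:] * D) X"
      by (simp only: Let_def X_def Xp_def Xm_def)
  qed
qed

lemma Dx_eqI:
  assumes "(\<beta>, c5) \<noteq> (0, 0)"
    and "\<And>s. quadratic_lattice \<beta> c5 (s + 1/2) \<noteq> quadratic_lattice \<beta> c5 (s - 1/2) \<Longrightarrow>
      poly g (quadratic_lattice \<beta> c5 s) =
        (poly f (quadratic_lattice \<beta> c5 (s + 1/2)) - poly f (quadratic_lattice \<beta> c5 (s - 1/2))) /
        (quadratic_lattice \<beta> c5 (s + 1/2) - quadratic_lattice \<beta> c5 (s - 1/2))"
  shows "Dx (quadratic_lattice \<beta> c5) f = g"
  unfolding Dx_def
proof (rule the_equality)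
  fix h
  assume h: "\<forall>s. quadratic_lattice \<beta> c5 (s + 1/2) \<noteq> quadratic_lattice \<beta> c5 (s - 1/2) \<longrightarrow>
      poly h (quadratic_lattice \<beta> c5 s) =
        (poly f (quadratic_lattice \<beta> c5 (s + 1/2)) - poly f (quadratic_lattice \<beta> c5 (s - 1/2))) /
        (quadratic_lattice \<beta> c5 (s + 1/2) - quadratic_lattice \<beta> c5 (s - 1/2))"
  show "h = g"
    by (rule poly_eq_on_infinite[OF infinite_lattice_image[OF assms(1)]])
       (use h assms(2) in auto)
qed (use assms(2) in blast)

lemma Sx_eqI:
  assumes "(\<beta>, c5) \<noteq> (0, 0)"
    and "\<And>s. poly g (quadratic_lattice \<beta> c5 s) =
        (poly f (quadratic_lattice \<beta> c5 (s + 1/2)) + poly f (quadratic_lattice \<beta> c5 (s - 1/2))) / 2"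
  shows "Sx (quadratic_lattice \<beta> c5) f = g"
  unfolding Sx_def
proof (rule the_equality)
  fix h
  assume h: "\<forall>s. poly h (quadratic_lattice \<beta> c5 s) =
        (poly f (quadratic_lattice \<beta> c5 (s + 1/2)) + poly f (quadratic_lattice \<beta> c5 (s - 1/2))) / 2"
  show "h = g"
    by (rule poly_eq_on_infinite[OF infinite_lattice_image[OF assms(1)]])
       (use h assms(2) in \<open>force simp del: eq_divide_eq_numeral1\<close>)
qed (use assms(2) in blast)

lemma Dx_lattice:
  assumes "(\<beta>, c5) \<noteq> (0, 0)"
    and "quadratic_lattice \<beta> c5 (s + 1/2) \<noteq> quadratic_lattice \<beta> c5 (s - 1/2)"
  shows "poly (Dx (quadratic_lattice \<beta> c5) f) (quadratic_lattice \<beta> c5 s) =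
    (poly f (quadratic_lattice \<beta> c5 (s + 1/2)) - poly f (quadratic_lattice \<beta> c5 (s - 1/2))) /
    (quadratic_lattice \<beta> c5 (s + 1/2) - quadratic_lattice \<beta> c5 (s - 1/2))"
proof -
  obtain D where D: "\<And>s. poly f (quadratic_lattice \<beta> c5 (s + 1/2)) -
      poly f (quadratic_lattice \<beta> c5 (s - 1/2)) =
      (quadratic_lattice \<beta> c5 (s + 1/2) - quadratic_lattice \<beta> c5 (s - 1/2)) *
      poly D (quadratic_lattice \<beta> c5 s)"
    using Dx_Sx_exist[of \<beta> c5 f] unfolding Let_def by blast
  have "Dx (quadratic_lattice \<beta> c5) f = D"
    by (rule Dx_eqI[OF assms(1)]) (simp add: D)
  then show ?thesis
    using assms(2) by (simp add: D)
qed

lemma Sx_lattice: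
  assumes "(\<beta>, c5) \<noteq> (0, 0)"
  shows "poly (Sx (quadratic_lattice \<beta> c5) f) (quadratic_lattice \<beta> c5 s) =
    (poly f (quadratic_lattice \<beta> c5 (s + 1/2)) + poly f (quadratic_lattice \<beta> c5 (s - 1/2))) / 2"
proof -
  obtain S where S: "\<And>s. poly f (quadratic_lattice \<beta> c5 (s + 1/2)) +
      poly f (quadratic_lattice \<beta> c5 (s - 1/2)) = 2 * poly S (quadratic_lattice \<beta> c5 s)"
    using Dx_Sx_exist[of \<beta> c5 f] unfolding Let_def by blast
  have "Sx (quadratic_lattice \<beta> c5) f = S"
    by (rule Sx_eqI[OF assms(1)]) (simp add: S)
  then show ?thesis
    by (simp add: S)
qed

definition cdHahn_admissible :: "complex \<Rightarrow> complex \<Rightarrow> complex \<Rightarrow> bool" where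
  "cdHahn_admissible t1 t2 t3 \<longleftrightarrow> - t1 - t2 \<notin> \<nat> \<and> - t1 - t3 \<notin> \<nat> \<and> - t2 - t3 \<notin> \<nat>"

definition cdHahn_B :: "complex \<Rightarrow> complex \<Rightarrow> complex \<Rightarrow> nat \<Rightarrow> complex" where
  "cdHahn_B t1 t2 t3 n = (of_nat n + t1 + t2) * (of_nat n + t1 + t3)
     + of_nat n * (of_nat n + t2 + t3 - 1) - t1\<^sup>2"

text \<open>The value at \<open>0\<close> is a dummy; it does not enter \<open>cdHahn\<close>.\<close>

fun cdHahn_C :: "complex \<Rightarrow> complex \<Rightarrow> complex \<Rightarrow> nat \<Rightarrow> complex" where
  "cdHahn_C t1 t2 t3 0 = 0"
| "cdHahn_C t1 t2 t3 (Suc n) =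
     of_nat (n + 1) * (of_nat n + t1 + t2) * (of_nat n + t1 + t3) * (of_nat n + t2 + t3)"

fun cdHahn :: "complex \<Rightarrow> complex \<Rightarrow> complex \<Rightarrow> nat \<Rightarrow> complex poly" where
  "cdHahn t1 t2 t3 0 = 1"
| "cdHahn t1 t2 t3 (Suc 0) = [:- cdHahn_B t1 t2 t3 0, 1:]"
| "cdHahn t1 t2 t3 (Suc (Suc n)) =
     [:- cdHahn_B t1 t2 t3 (Suc n), 1:] * cdHahn t1 t2 t3 (Suc n)
     - smult (cdHahn_C t1 t2 t3 (Suc n)) (cdHahn t1 t2 t3 n)"

end

theory Submission
  imports Defs
begin

text \<open>
  Put \<open>s n = Sx (P n)\<close>, \<open>d n = Dx (P n)\<close> and \<open>K = c5\<^sup>2/4 - 4\<beta>c\<close>, the value at \<open>-c\<close> of the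
  polynomial \<open>4\<beta>z + c5\<^sup>2/4\<close> in the product rule for \<open>Sx\<close>. The recurrence for \<open>P\<close> turns into
  recurrences for \<open>s\<close> and \<open>d\<close>, and eliminating with the structure relation yields a linear relation
  with constant coefficients between \<open>K d (n + 1)\<close>, \<open>K d n\<close>, \<open>s n\<close>, \<open>s (n - 1)\<close>.
  If \<open>K = 0\<close>, both coefficients of the \<open>s\<close>-terms vanish; this forces \<open>c_n\<close> to be a cubic polynomial
  in \<open>n\<close> and determines \<open>B_n\<close> and \<open>C_n\<close> as those of the first family.
  If \<open>K \<noteq> 0\<close>, further elimination gives \<open>d (n + 1) = (n + 1) s n + g_n d n\<close>, and the resulting
  equations for \<open>c_2, \<dots>, c_5\<close> are inconsistent.
\<close>

section \<open>Calculus of \<open>Dx\<close> and \<open>Sx\<close> on the lattice\<close>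

text \<open>Valid also where \<open>8 * \<beta> * s + c5\<close> vanishes: \<open>Dx\<close> agrees
  with the polynomial from \<open>Dx_Sx_exist\<close>, whose defining identity contains no
  denominator.\<close>

lemma Dx_Sx_values:
  assumes "(\<beta>, c5) \<noteq> (0, 0)"
  shows "poly f (quadratic_lattice \<beta> c5 (s + 1/2)) =
      poly (Sx (quadratic_lattice \<beta> c5) f) (quadratic_lattice \<beta> c5 s)
      + (8 * \<beta> * s + c5) / 2 * poly (Dx (quadratic_lattice \<beta> c5) f) (quadratic_lattice \<beta> c5 s)"
    and "poly f (quadratic_lattice \<beta> c5 (s - 1/2)) =
      poly (Sx (quadratic_lattice \<beta> c5) f) (quadratic_lattice \<beta> c5 s)
      - (8 * \<beta> * s + c5) / 2 * poly (Dx (quadratic_lattice \<beta> c5) f) (quadratic_lattice \<beta> c5 s)"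
proof -
  let ?x = "quadratic_lattice \<beta> c5"
  have S: "poly f (?x (s + 1/2)) + poly f (?x (s - 1/2)) = 2 * poly (Sx ?x f) (?x s)"
    by (simp add: Sx_lattice[OF assms])
  obtain D where D: "\<And>s. poly f (?x (s + 1/2)) - poly f (?x (s - 1/2)) =
      (?x (s + 1/2) - ?x (s - 1/2)) * poly D (?x s)"
    using Dx_Sx_exist[of \<beta> c5 f] unfolding Let_def by blast
  have "Dx ?x f = D"
    by (rule Dx_eqI[OF assms]) (simp add: D)
  then have "poly f (?x (s + 1/2)) - poly f (?x (s - 1/2)) = (8 * \<beta> * s + c5) * poly (Dx ?x f) (?x s)"
    using D[of s] by (simp add: quadratic_lattice_diff)
  with S show "poly f (?x (s + 1/2)) = poly (Sx ?x f) (?x s) + (8 * \<beta> * s + c5) / 2 * poly (Dx ?x f) (?x s)"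
    and "poly f (?x (s - 1/2)) = poly (Sx ?x f) (?x s) - (8 * \<beta> * s + c5) / 2 * poly (Dx ?x f) (?x s)"
    by algebra+
qed

lemma Dx_Sx_eqI:
  assumes "(\<beta>, c5) \<noteq> (0, 0)"
    and "\<And>s. poly f (quadratic_lattice \<beta> c5 (s + 1/2)) = poly g (quadratic_lattice \<beta> c5 s)
      + (8 * \<beta> * s + c5) / 2 * poly h (quadratic_lattice \<beta> c5 s)"
    and "\<And>s. poly f (quadratic_lattice \<beta> c5 (s - 1/2)) = poly g (quadratic_lattice \<beta> c5 s)
      - (8 * \<beta> * s + c5) / 2 * poly h (quadratic_lattice \<beta> c5 s)"
  shows "Dx (quadratic_lattice \<beta> c5) f = h" and "Sx (quadratic_lattice \<beta> c5) f = g"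
proof -
  show "Dx (quadratic_lattice \<beta> c5) f = h"
  proof (rule Dx_eqI[OF assms(1)])
    fix s
    assume "quadratic_lattice \<beta> c5 (s + 1/2) \<noteq> quadratic_lattice \<beta> c5 (s - 1/2)"
    then have "8 * \<beta> * s + c5 \<noteq> 0"
      using quadratic_lattice_diff[of \<beta> c5 s] by auto
    then show "poly h (quadratic_lattice \<beta> c5 s) =
        (poly f (quadratic_lattice \<beta> c5 (s + 1/2)) - poly f (quadratic_lattice \<beta> c5 (s - 1/2))) /
        (quadratic_lattice \<beta> c5 (s + 1/2) - quadratic_lattice \<beta> c5 (s - 1/2))"
      unfolding quadratic_lattice_diff assms(2,3) by simp
  qed
  show "Sx (quadratic_lattice \<beta> c5) f = g"
    by (rule Sx_eqI[OF assms(1)]) (simp add: assms(2,3))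
qed

text \<open>With \<open>y = (8 * \<beta> * s + c5) / 2\<close> the shifted nodes are
  \<open>x(s) + \<beta> + y\<close> and \<open>x(s) + \<beta> - y\<close>, and
  \<open>y\<^sup>2\<close> is a polynomial in \<open>x(s)\<close>. Expanding in \<open>y\<close>,
  the even part gives \<open>Sx\<close> and the odd part gives \<open>Dx\<close>.\<close>

lemma Dx_Sx_recurrence:
  assumes "(\<beta>, c5) \<noteq> (0, 0)"
  shows "Dx (quadratic_lattice \<beta> c5) ([:- b, 1:] * f - smult k g) =
      Sx (quadratic_lattice \<beta> c5) f + [:\<beta> - b, 1:] * Dx (quadratic_lattice \<beta> c5) f
      - smult k (Dx (quadratic_lattice \<beta> c5) g)"
    and "Sx (quadratic_lattice \<beta> c5) ([:- b, 1:] * f - smult k g) =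
      [:\<beta> - b, 1:] * Sx (quadratic_lattice \<beta> c5) f
      + [:c5\<^sup>2 / 4, 4 * \<beta>:] * Dx (quadratic_lattice \<beta> c5) f
      - smult k (Sx (quadratic_lattice \<beta> c5) g)"
proof -
  let ?x = "quadratic_lattice \<beta> c5"
  note f = Dx_Sx_values[OF assms, of f] and g = Dx_Sx_values[OF assms, of g]
  have p: "?x (s + 1/2) = ?x s + \<beta> + (8 * \<beta> * s + c5) / 2"
    and m: "?x (s - 1/2) = ?x s + \<beta> - (8 * \<beta> * s + c5) / 2"
    and q: "((8 * \<beta> * s + c5) / 2)\<^sup>2 = c5\<^sup>2 / 4 + 4 * \<beta> * ?x s" for s
    by (simp_all add: quadratic_lattice_def power2_eq_square field_simps)
  have plus: "(X + \<beta> + y - b) * (S + y * D) - k * (S' + y * D') =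
      ((X + \<beta> - b) * S + q * D - k * S') + y * (S + (X + \<beta> - b) * D - k * D')"
    and minus: "(X + \<beta> - y - b) * (S - y * D) - k * (S' - y * D') =
      ((X + \<beta> - b) * S + q * D - k * S') - y * (S + (X + \<beta> - b) * D - k * D')"
    if "y\<^sup>2 = q" for X y S D S' D' q :: complex
    unfolding that[symmetric] by (simp_all add: power2_eq_square algebra_simps)
  let ?S = "[:\<beta> - b, 1:] * Sx ?x f + [:c5\<^sup>2 / 4, 4 * \<beta>:] * Dx ?x f - smult k (Sx ?x g)"
  let ?D = "Sx ?x f + [:\<beta> - b, 1:] * Dx ?x f - smult k (Dx ?x g)"
  have 1: "poly ([:- b, 1:] * f - smult k g) (?x (s + 1/2)) =
      poly ?S (?x s) + (8 * \<beta> * s + c5) / 2 * poly ?D (?x s)" for s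
  proof -
    have "poly ([:- b, 1:] * f - smult k g) (?x (s + 1/2)) =
        (?x s + \<beta> + (8 * \<beta> * s + c5) / 2 - b) * poly f (?x (s + 1/2)) - k * poly g (?x (s + 1/2))"
      by (simp add: p algebra_simps)
    also have "\<dots> = ((?x s + \<beta> - b) * poly (Sx ?x f) (?x s) + (c5\<^sup>2 / 4 + 4 * \<beta> * ?x s) * poly (Dx ?x f) (?x s)
        - k * poly (Sx ?x g) (?x s)) + (8 * \<beta> * s + c5) / 2 * (poly (Sx ?x f) (?x s)
        + (?x s + \<beta> - b) * poly (Dx ?x f) (?x s) - k * poly (Dx ?x g) (?x s))"
      unfolding f g by (rule plus[OF q])
    finally show ?thesis by (simp add: algebra_simps)
  qed
  have 2: "poly ([:- b, 1:] * f - smult k g) (?x (s - 1/2)) =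
      poly ?S (?x s) - (8 * \<beta> * s + c5) / 2 * poly ?D (?x s)" for s
  proof -
    have "poly ([:- b, 1:] * f - smult k g) (?x (s - 1/2)) =
        (?x s + \<beta> - (8 * \<beta> * s + c5) / 2 - b) * poly f (?x (s - 1/2)) - k * poly g (?x (s - 1/2))"
      by (simp add: m algebra_simps)
    also have "\<dots> = ((?x s + \<beta> - b) * poly (Sx ?x f) (?x s) + (c5\<^sup>2 / 4 + 4 * \<beta> * ?x s) * poly (Dx ?x f) (?x s)
        - k * poly (Sx ?x g) (?x s)) - (8 * \<beta> * s + c5) / 2 * (poly (Sx ?x f) (?x s)
        + (?x s + \<beta> - b) * poly (Dx ?x f) (?x s) - k * poly (Dx ?x g) (?x s))"
      unfolding f g by (rule minus[OF q])
    finally show ?thesis by (simp add: algebra_simps)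
  qed
  show "Dx ?x ([:- b, 1:] * f - smult k g) = ?D" "Sx ?x ([:- b, 1:] * f - smult k g) = ?S"
    using Dx_Sx_eqI[OF assms 1 2] by blast+
qed

lemma Dx_Sx_one:
  assumes "(\<beta>, c5) \<noteq> (0, 0)"
  shows "Dx (quadratic_lattice \<beta> c5) 1 = 0" and "Sx (quadratic_lattice \<beta> c5) 1 = 1"
  using Dx_Sx_eqI[OF assms, of 1 1 0] by simp_all

text \<open>Here \<open>a n\<close> is the coefficient \<open>c_n\<close> and \<open>e n\<close> is \<open>B n + c - \<beta>\<close>. With \<open>a 0 = C 0 = 0\<close> the terms of index \<open>n - 1\<close> are
  correct also at \<open>n = 0\<close>, where the subtraction truncates.\<close>

locale structure_relation =
  fixes s d :: "nat \<Rightarrow> complex poly" and \<beta> c K :: complex and a b e C :: "nat \<Rightarrow> complex"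
  assumes s_0: "s 0 = 1" and d_0: "d 0 = 0"
    and d_Suc: "\<And>n. d (Suc n) = s n + [:c - e n, 1:] * d n - smult (C n) (d (n - 1))"
    and s_Suc: "\<And>n. s (Suc n) = [:c - e n, 1:] * s n + [:4 * \<beta> * c + K, 4 * \<beta>:] * d n
                   - smult (C n) (s (n - 1))"
    and rel: "\<And>n. [:c, 1:] * d n = smult (b n) (s n) + smult (a n) (s (n - 1))"
    and a_0: "a 0 = 0" and a_nonzero: "\<And>n. n \<ge> 1 \<Longrightarrow> a n \<noteq> 0"
    and C_0: "C 0 = 0" and C_nonzero: "\<And>n. n \<ge> 1 \<Longrightarrow> C n \<noteq> 0"
begin

section \<open>Leading coefficients and the value of \<open>b n\<close>\<close>

text \<open>Strong induction on both sequences at once, since their recurrences are coupled and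
  reach back two indices. These top coefficients feed all later coefficient comparisons.\<close>

lemma coeff_s_d:
  "(\<forall>k>n. coeff (s n) k = 0) \<and> coeff (s n) n = 1 \<and>
   (\<forall>k\<ge>n. coeff (d n) k = 0) \<and> coeff (d (Suc n)) n = of_nat (Suc n)"
proof (induction n rule: less_induct)
  case (less n)
  show ?case
  proof (cases n)
    case 0
    then show ?thesis by (simp add: s_0 d_0 d_Suc C_0)
  next
    case (Suc m)
    have s: "coeff (s j) k = 0" if "k > j" "j < n" for j k
      using less that by blast
    have d: "coeff (d j) k = 0" if "k \<ge> j" "j < n" for j k
      using less that by blast
    have sm: "coeff (s m) m = 1" and dm: "coeff (d (Suc m)) m = of_nat (Suc m)"
      using less[of m] Suc by auto
    have dk: "coeff (d n) k = 0" if "k \<ge> n" for k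
      using that Suc by (cases k) (auto simp: d_Suc s d coeff_pCons split: nat.split)
    have sk: "coeff (s n) k = 0" if "k > n" for k
      using that Suc by (cases k) (auto simp: s_Suc s d coeff_pCons split: nat.split)
    have sn: "coeff (s n) n = 1"
      using Suc sm by (auto simp: s_Suc s d coeff_pCons split: nat.split)
    have "coeff (d (Suc n)) n = of_nat (Suc n)"
      using Suc sm sn dm dk[of n] by (simp add: d_Suc[of "Suc m"] d coeff_pCons)
    with dk sk sn show ?thesis by blast
  qed
qed

lemma s_coeff [simp]: "k > n \<Longrightarrow> coeff (s n) k = 0" "coeff (s n) n = 1"
  and d_coeff [simp]: "k \<ge> n \<Longrightarrow> coeff (d n) k = 0" "coeff (d (Suc n)) n = of_nat (Suc n)"
  using coeff_s_d[of n] by auto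

lemma s_nonzero: "s n \<noteq> 0"
  by (metis s_coeff(2) coeff_0 zero_neq_one)

lemma d_nonzero: "d (Suc n) \<noteq> 0"
  by (metis d_coeff(2) coeff_0 of_nat_neq_0)

lemma b_eq: "b n = of_nat n"
proof (cases n)
  case 0
  then show ?thesis using arg_cong[OF rel[of 0], of "\<lambda>p. coeff p 0"]
    by (simp add: d_0 s_0 a_0)
next
  case (Suc m)
  then show ?thesis using arg_cong[OF rel[of n], of "\<lambda>p. coeff p n"]
    by (simp add: coeff_pCons)
qed

lemma rel_poly: "(z + c) * poly (d n) z = of_nat n * poly (s n) z + a n * poly (s (n - 1)) z"
  using arg_cong[OF rel[of n], of "\<lambda>p. poly p z"] by (simp add: b_eq algebra_simps)

lemma d_Suc_poly:
  "poly (d (Suc n)) z = poly (s n) z + (z + c - e n) * poly (d n) z - C n * poly (d (n - 1)) z"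
  by (simp add: d_Suc algebra_simps)

lemma s_Suc_poly:
  "poly (s (Suc n)) z = (z + c - e n) * poly (s n) z + (4 * \<beta> * (z + c) + K) * poly (d n) z
     - C n * poly (s (n - 1)) z"
  by (simp add: s_Suc algebra_simps)

text \<open>Substitute the recurrences for \<open>d (n + 2)\<close> and \<open>s (n + 2)\<close> into \<open>rel\<close> at index \<open>n + 2\<close>,
  and remove the products \<open>(z + c) d\<close> by \<open>rel\<close>.\<close>

lemma elimination_relation:
  "smult (a (Suc (Suc n)) - e (Suc n) + 4 * \<beta> * of_nat (Suc n) * of_nat (Suc (Suc n))) (s (Suc n))
   + smult (of_nat (Suc (Suc n)) * K) (d (Suc n))
   + [:4 * \<beta> * of_nat (Suc (Suc n)) * a (Suc n) - a (Suc n) * (c - e (Suc n)) - 2 * C (Suc n), - a (Suc n):] * s n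
   + smult (C (Suc n) * a n) (s (n - 1)) = 0"
proof (rule poly_eq_poly_eq_iff[THEN iffD1, OF ext])
  fix z
  define w where "w = z + c"
  have r0: "w * poly (d n) z = of_nat n * poly (s n) z + a n * poly (s (n - 1)) z"
    and r1: "w * poly (d (Suc n)) z = of_nat (Suc n) * poly (s (Suc n)) z + a (Suc n) * poly (s n) z"
    and r2: "w * poly (d (Suc (Suc n))) z = of_nat (Suc (Suc n)) * poly (s (Suc (Suc n))) z + a (Suc (Suc n)) * poly (s (Suc n)) z"
    and d2: "poly (d (Suc (Suc n))) z = poly (s (Suc n)) z + (w - e (Suc n)) * poly (d (Suc n)) z - C (Suc n) * poly (d n) z"
    and s2: "poly (s (Suc (Suc n))) z = (w - e (Suc n)) * poly (s (Suc n)) z + (4 * \<beta> * w + K) * poly (d (Suc n)) z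
     - C (Suc n) * poly (s n) z"
    using rel_poly[of z n] rel_poly[of z "Suc n"] rel_poly[of z "Suc (Suc n)"]
      d_Suc_poly[of "Suc n" z] s_Suc_poly[of "Suc n" z]
    by (simp_all add: w_def)
  have c: "c = w - z" by (simp add: w_def)
  have "(a (Suc (Suc n)) - e (Suc n) + 4 * \<beta> * of_nat (Suc n) * of_nat (Suc (Suc n))) * poly (s (Suc n)) z
     + of_nat (Suc (Suc n)) * K * poly (d (Suc n)) z
     + (4 * \<beta> * of_nat (Suc (Suc n)) * a (Suc n) - a (Suc n) * (w - e (Suc n)) - 2 * C (Suc n)) * poly (s n) z
     + C (Suc n) * a n * poly (s (n - 1)) z = 0"
    using r0 r1 r2 d2 s2 unfolding of_nat_Suc by algebra
  then show "poly (smult (a (Suc (Suc n)) - e (Suc n) + 4 * \<beta> * of_nat (Suc n) * of_nat (Suc (Suc n))) (s (Suc n))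
   + smult (of_nat (Suc (Suc n)) * K) (d (Suc n))
   + [:4 * \<beta> * of_nat (Suc (Suc n)) * a (Suc n) - a (Suc n) * (c - e (Suc n)) - 2 * C (Suc n), - a (Suc n):] * s n
   + smult (C (Suc n) * a n) (s (n - 1))) z = poly 0 z"
    unfolding c by (simp add: algebra_simps)
qed

section \<open>Recurrence coefficients expressed through \<open>a\<close>\<close>

text \<open>For positive \<open>n\<close> this is the coefficient of \<open>z^n\<close> in
  \<open>elimination_relation\<close> at \<open>n - 1\<close>, where the \<open>d\<close>-term has
  too low a degree to contribute. For \<open>n = 0\<close> it is \<open>rel\<close> at index
  1.\<close>

lemma e_eq: "e n = a (Suc n) - a n + 4 * \<beta> * of_nat n * of_nat (Suc n)"
proof (cases n)
  case 0
  then show ?thesis using rel[of 1]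
    by (simp add: d_Suc s_Suc d_0 s_0 C_0 a_0 b_eq)
next
  case (Suc m)
  show ?thesis
    using arg_cong[OF elimination_relation[of m], of "\<lambda>p. coeff p n"]
    by (simp add: Suc coeff_pCons algebra_simps)
qed

text \<open>By \<open>e_eq\<close> the factor of \<open>s (Suc n)\<close> in
  \<open>elimination_relation\<close> is \<open>a (Suc n)\<close>. Expanding
  \<open>s (Suc n)\<close> by its recurrence then cancels the term \<open>z * s n\<close>, and
  \<open>rel\<close> absorbs the remaining product \<open>(z + c) * d n\<close>.\<close>

lemma constant_coeff_relation:
  "smult (of_nat (Suc (Suc n)) * K) (d (Suc n)) + smult (a (Suc n) * K) (d n)
   + smult ((a (Suc (Suc n)) - 2 * a (Suc n) + a n + 16 * \<beta> * of_nat (Suc n)) * a (Suc n) - 2 * C (Suc n)) (s n)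
   + smult (C (Suc n) * a n + a (Suc n) * (4 * \<beta> * a n - C n)) (s (n - 1)) = 0"
proof (rule poly_eq_poly_eq_iff[THEN iffD1, OF ext])
  fix z
  have 1: "(a (Suc (Suc n)) - e (Suc n) + 4 * \<beta> * of_nat (Suc n) * of_nat (Suc (Suc n))) * poly (s (Suc n)) z
     + of_nat (Suc (Suc n)) * K * poly (d (Suc n)) z
     + (4 * \<beta> * of_nat (Suc (Suc n)) * a (Suc n) - a (Suc n) * (z + c - e (Suc n)) - 2 * C (Suc n)) * poly (s n) z
     + C (Suc n) * a n * poly (s (n - 1)) z = 0"
    using arg_cong[OF elimination_relation[of n], of "\<lambda>p. poly p z"] by (simp add: algebra_simps)
  show "poly (smult (of_nat (Suc (Suc n)) * K) (d (Suc n)) + smult (a (Suc n) * K) (d n)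
   + smult ((a (Suc (Suc n)) - 2 * a (Suc n) + a n + 16 * \<beta> * of_nat (Suc n)) * a (Suc n) - 2 * C (Suc n)) (s n)
   + smult (C (Suc n) * a n + a (Suc n) * (4 * \<beta> * a n - C n)) (s (n - 1))) z = poly 0 z"
    unfolding poly_add poly_smult poly_0
    using 1 s_Suc_poly[of n z] rel_poly[of z n] e_eq[of n] e_eq[of "Suc n"] unfolding of_nat_Suc by algebra
qed

text \<open>The product \<open>(z + c) * d n\<close> in the recurrence is replaced by
  \<open>rel\<close>, so that only constant coefficients remain.\<close>

lemma d_expansion:
  "d (Suc n) = smult (of_nat (Suc n)) (s n) + smult (a n) (s (n - 1)) - smult (e n) (d n)
     - smult (C n) (d (n - 1))"
proof (rule poly_eq_poly_eq_iff[THEN iffD1, OF ext])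
  fix z
  show "poly (d (Suc n)) z = poly (smult (of_nat (Suc n)) (s n) + smult (a n) (s (n - 1))
     - smult (e n) (d n) - smult (C n) (d (n - 1))) z"
    unfolding poly_add poly_diff poly_smult
    using d_Suc_poly[of n z] rel_poly[of z n] unfolding of_nat_Suc by algebra
qed

lemma s_independent:
  assumes "smult x (s (Suc n)) + smult y (s n) = 0"
  shows "x = 0" "y = 0"
proof -
  show "x = 0" using arg_cong[OF assms, of "\<lambda>p. coeff p (Suc n)"] by simp
  with assms show "y = 0" using s_nonzero by simp
qed

lemma s_d_independent:
  assumes "smult x (s (Suc n)) + smult y (d (Suc n)) = 0"
  shows "x = 0" "y = 0"
proof -
  show "x = 0" using arg_cong[OF assms, of "\<lambda>p. coeff p (Suc n)"] by simp
  with assms show "y = 0" using d_nonzero by simp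
qed

text \<open>Coefficient of \<open>z^n\<close> in \<open>constant_coeff_relation\<close>. At
  \<open>n = 0\<close> the truncated index leaves \<open>s 0\<close>, but its factor vanishes by
  \<open>a_0\<close> and \<open>C_0\<close>.\<close>

lemma C_eq: "2 * C (Suc n) = of_nat (Suc n) * of_nat (Suc (Suc n)) * K
    + (a (Suc (Suc n)) - 2 * a (Suc n) + a n + 16 * \<beta> * of_nat (Suc n)) * a (Suc n)"
  using arg_cong[OF constant_coeff_relation[of n], of "\<lambda>p. coeff p n"]
  by (cases n) (simp_all add: a_0 C_0 algebra_simps)

section \<open>The case K = 0\<close>

text \<open>Only \<open>s n\<close> and \<open>s (n - 1)\<close> survive in
  \<open>constant_coeff_relation\<close>, so their coefficients vanish. The second one says that
  \<open>C n / a n\<close> drops by \<open>4 * \<beta>\<close> at each step, hence is affine in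
  \<open>n\<close>; \<open>\<kappa>\<close> is its value at 1, and \<open>\<mu>\<close> is fitted to
  \<open>a 1\<close>.\<close>

lemma solution_of_K_zero:
  assumes "K = 0"
  obtains \<kappa> \<mu> where
    "\<And>n. a n = of_nat n * (- 4 * \<beta> * (of_nat n)\<^sup>2 + (\<kappa> + 4 * \<beta>) * of_nat n + \<mu>)"
    "\<And>n. C n = a n * (\<kappa> + 4 * \<beta> - 4 * \<beta> * of_nat n)"
proof
  define \<kappa> where "\<kappa> = C 1 / a 1"
  define \<mu> where "\<mu> = a 1 - \<kappa>"
  have step: "C (Suc (Suc n)) * a (Suc n) + a (Suc (Suc n)) * (4 * \<beta> * a (Suc n) - C (Suc n)) = 0" for n
    using s_independent(2) constant_coeff_relation[of "Suc n"] by (simp add: assms)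
  have C_Suc: "C (Suc n) = a (Suc n) * (\<kappa> - 4 * \<beta> * of_nat n)" for n
  proof (induction n)
    case 0
    then show ?case using a_nonzero[of 1] by (simp add: \<kappa>_def)
  next
    case (Suc n)
    have "a (Suc n) * (C (Suc (Suc n)) - a (Suc (Suc n)) * (\<kappa> - 4 * \<beta> * of_nat (Suc n))) = 0"
      using step[of n] Suc.IH unfolding of_nat_Suc by algebra
    then show ?case using a_nonzero[of "Suc n"] by simp
  qed
  show "C n = a n * (\<kappa> + 4 * \<beta> - 4 * \<beta> * of_nat n)" for n
    by (cases n) (simp_all add: C_0 a_0 C_Suc algebra_simps)
  \<comment> \<open>Cancelling \<open>a (Suc n)\<close> in \<open>C_eq\<close> leaves an affine
    second difference of \<open>a\<close>, which makes \<open>a\<close> cubic.\<close>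
  have a_step: "a (Suc (Suc n)) = 2 * (\<kappa> - 4 * \<beta> * of_nat n) + 2 * a (Suc n) - a n - 16 * \<beta> * of_nat (Suc n)" for n
  proof -
    have "a (Suc n) * (a (Suc (Suc n)) - (2 * (\<kappa> - 4 * \<beta> * of_nat n) + 2 * a (Suc n) - a n - 16 * \<beta> * of_nat (Suc n))) = 0"
      using C_eq[of n] C_Suc[of n] assms by algebra
    then show ?thesis using a_nonzero[of "Suc n"] by simp
  qed
  show "a n = of_nat n * (- 4 * \<beta> * (of_nat n)\<^sup>2 + (\<kappa> + 4 * \<beta>) * of_nat n + \<mu>)" for n
  proof (induction n rule: induct_nat_012)
    case 0
    show ?case by (simp add: a_0)
  next
    case 1
    show ?case by (simp add: \<mu>_def)
  next
    case (ge2 n)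
    show ?case
      unfolding a_step ge2 of_nat_Suc by algebra
  qed
qed

section \<open>Inconsistency of the case K nonzero\<close>

context
  assumes K_nonzero: "K \<noteq> 0"
begin

text \<open>Insert \<open>d_expansion\<close> for \<open>d (n + 2)\<close> into
  \<open>constant_coeff_relation\<close> at \<open>Suc n\<close>; the coefficient of
  \<open>s (Suc n)\<close> then vanishes by \<open>C_eq\<close>. What remains links
  \<open>d (Suc n)\<close>, \<open>d n\<close> and \<open>s n\<close>.\<close>

lemma d_relation:
  "smult (a (Suc (Suc n)) - of_nat (n + 3) * e (Suc n)) (d (Suc n) - smult (of_nat (Suc n)) (s n))
   = smult (of_nat (n + 3) * C (Suc n)) (d n)"
proof -
  define X where "X = a (Suc (Suc n)) - of_nat (n + 3) * e (Suc n)"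
  define Y where "Y = of_nat (n + 3) * K * a (Suc n) + C (Suc (Suc n)) * a (Suc n)
    + a (Suc (Suc n)) * (4 * \<beta> * a (Suc n) - C (Suc n))"
  have eq: "smult (X * K) (d (Suc n)) - smult (of_nat (n + 3) * K * C (Suc n)) (d n) + smult Y (s n) = 0"
  proof (rule poly_eq_poly_eq_iff[THEN iffD1, OF ext])
    fix z
    show "poly (smult (X * K) (d (Suc n)) - smult (of_nat (n + 3) * K * C (Suc n)) (d n) + smult Y (s n)) z
        = poly 0 z"
      using arg_cong[OF constant_coeff_relation[of "Suc n"], of "\<lambda>p. poly p z"]
        arg_cong[OF d_expansion[of "Suc n"], of "\<lambda>p. poly p z"] C_eq[of "Suc n"]
      unfolding poly_add poly_diff poly_smult poly_0 X_def Y_def of_nat_Suc of_nat_add diff_Suc_1 of_nat_numeral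
      by algebra
  qed
  \<comment> \<open>The top coefficient expresses \<open>Y\<close> through \<open>X\<close>;
    afterwards the factor \<open>K\<close> can be cancelled.\<close>
  have "X * K * of_nat (Suc n) + Y = 0"
    using arg_cong[OF eq, of "\<lambda>p. coeff p n"] by (simp add: algebra_simps)
  then have Y: "Y = - (X * K * of_nat (Suc n))"
    by (simp add: eq_neg_iff_add_eq_0 add.commute)
  have "smult K (smult X (d (Suc n) - smult (of_nat (Suc n)) (s n))) = smult K (smult (of_nat (n + 3) * C (Suc n)) (d n))"
  proof (rule poly_eq_poly_eq_iff[THEN iffD1, OF ext])
    fix z
    show "poly (smult K (smult X (d (Suc n) - smult (of_nat (Suc n)) (s n)))) z
        = poly (smult K (smult (of_nat (n + 3) * C (Suc n)) (d n))) z"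
      using arg_cong[OF eq, of "\<lambda>p. poly p z"] Y
      unfolding poly_add poly_diff poly_smult poly_0 by algebra
  qed
  then have "smult K (smult X (d (Suc n) - smult (of_nat (Suc n)) (s n)) - smult (of_nat (n + 3) * C (Suc n)) (d n)) = 0"
    by (simp add: smult_diff_right)
  then show ?thesis
    using K_nonzero by (simp add: X_def del: of_nat_Suc of_nat_add)
qed

text \<open>Division of \<open>d_relation\<close> by its left factor, which cannot vanish because
  \<open>C (n + 2)\<close> and \<open>d (n + 1)\<close> are nonzero. The index is shifted by one
  because \<open>d 0 = 0\<close>.\<close>

lemma d_two_term:
  obtains g where
    "\<And>n. d (n + 2) = smult (of_nat (n + 2)) (s (n + 1)) + smult (g n) (d (n + 1))"
    "\<And>n. (a (n + 3) - of_nat (n + 4) * e (n + 2)) * g n = of_nat (n + 4) * C (n + 2)"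
proof
  define X where "X n = a (n + 3) - of_nat (n + 4) * e (n + 2)" for n
  define g where "g n = of_nat (n + 4) * C (n + 2) / X n" for n
  have rel3: "smult (X n) (d (n + 2) - smult (of_nat (n + 2)) (s (n + 1)))
      = smult (of_nat (n + 4) * C (n + 2)) (d (n + 1))" for n
    using d_relation[of "n + 1"] by (simp add: X_def numeral_eq_Suc)
  have X: "X n \<noteq> 0" for n
  proof
    assume "X n = 0"
    then have "of_nat (n + 4) * C (n + 2) = 0"
      using rel3[of n] d_nonzero[of n] by simp
    then show False
      using C_nonzero[of "n + 2"] of_nat_neq_0[of "n + 3", where 'a = complex] by (simp add: add.commute)
  qed
  show "(a (n + 3) - of_nat (n + 4) * e (n + 2)) * g n = of_nat (n + 4) * C (n + 2)" for n
    using X[of n] unfolding X_def[symmetric] by (simp add: g_def)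
  have diff: "smult (X n) (d (n + 2) - smult (of_nat (n + 2)) (s (n + 1)) - smult (g n) (d (n + 1))) = 0" for n
    unfolding smult_diff_right[of _ "_ - _"] rel3 using X[of n] by (simp add: g_def)
  show "d (n + 2) = smult (of_nat (n + 2)) (s (n + 1)) + smult (g n) (d (n + 1))" for n
    using diff[of n] X[of n] by (simp add: algebra_simps)
qed

lemma no_solution_of_K_nonzero: False
proof -
  obtain g where g: "\<And>n. d (n + 2) = smult (of_nat (n + 2)) (s (n + 1)) + smult (g n) (d (n + 1))"
    and Xg: "\<And>n. (a (n + 3) - of_nat (n + 4) * e (n + 2)) * g n = of_nat (n + 4) * C (n + 2)"
    using d_two_term by blast
  \<comment> \<open>Both \<open>d_expansion\<close> and the two-term formula express
    \<open>d (n + 3)\<close> with the same \<open>s (n + 2)\<close> term. Their difference is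
    compared in the independent pair \<open>s (n + 1)\<close>, \<open>d (n + 1)\<close>.\<close>
  have G: "(g (n + 1) + e (n + 2)) * of_nat (n + 2) = a (n + 2)"
    "(g (n + 1) + e (n + 2)) * g n = - C (n + 2)" for n
  proof -
    define G where "G = g (n + 1) + e (n + 2)"
    have "smult G (d (n + 2)) = smult (a (n + 2)) (s (n + 1)) - smult (C (n + 2)) (d (n + 1))"
      using d_expansion[of "n + 2"] g[of "n + 1"]
      by (simp add: G_def numeral_eq_Suc algebra_simps smult_add_left)
    then have "smult (G * of_nat (n + 2) - a (n + 2)) (s (Suc n)) + smult (G * g n + C (n + 2)) (d (Suc n)) = 0"
      unfolding g by (simp add: algebra_simps smult_add_left smult_diff_left smult_add_right)
    from s_d_independent[OF this] show "G * of_nat (n + 2) = a (n + 2)" "G * g n = - C (n + 2)"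
      by (simp_all add: eq_neg_iff_add_eq_0)
  qed
  have ag: "a (n + 2) * g n = - of_nat (n + 2) * C (n + 2)" for n
  proof -
    have "a (n + 2) * g n = of_nat (n + 2) * ((g (n + 1) + e (n + 2)) * g n)"
      unfolding G(1)[symmetric] by (simp only: mult_ac)
    then show ?thesis unfolding G(2) by (simp only: mult_minus_left mult_minus_right)
  qed
  \<comment> \<open>Eliminating \<open>C (n + 2)\<close> between \<open>ag\<close> and
    \<open>Xg\<close> leaves the nonzero factor \<open>g n\<close>. The result is linear in
    \<open>a\<close>; three instances suffice.\<close>
  have L: "of_nat (n + 4) * a (n + 2) + of_nat (n + 2) * (a (n + 3) - of_nat (n + 4) * e (n + 2)) = 0" for n
  proof -
    have "g n * (of_nat (n + 4) * a (n + 2) + of_nat (n + 2) * (a (n + 3) - of_nat (n + 4) * e (n + 2))) = 0"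
      using ag[of n] Xg[of n] by algebra
    moreover have "g n \<noteq> 0" using G(2)[of n] C_nonzero[of "n + 2"] by auto
    ultimately show ?thesis by simp
  qed
  have e2: "e 2 = a 3 - a 2 + 24 * \<beta>" and e3: "e 3 = a 4 - a 3 + 48 * \<beta>"
    and e4: "e 4 = a 5 - a 4 + 80 * \<beta>"
    using e_eq[of 2] e_eq[of 3] e_eq[of 4] by (simp_all add: eval_nat_numeral)
  have L0: "4 * a 2 + 2 * (a 3 - 4 * e 2) = 0" and L1: "5 * a 3 + 3 * (a 4 - 5 * e 3) = 0"
    and L2: "6 * a 4 + 4 * (a 5 - 6 * e 4) = 0"
    using L[of 0] L[of 1] L[of 2] by (simp_all add: eval_nat_numeral)
  have k0: "4 * a 2 = 2 * a 3 + 64 * \<beta>" using L0 e2 by algebra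
  have k1: "5 * a 3 = 3 * a 4 + 180 * \<beta>" using L1 e3 by algebra
  have k2: "6 * a 4 = 4 * a 5 + 384 * \<beta>" using L2 e4 by algebra
  have C3: "2 * C 3 = 12 * K + (a 4 - 2 * a 3 + a 2 + 48 * \<beta>) * a 3"
    and C4: "2 * C 4 = 20 * K + (a 5 - 2 * a 4 + a 3 + 64 * \<beta>) * a 4"
    using C_eq[of 2] C_eq[of 3] by (simp_all add: eval_nat_numeral)
  have ag3: "a 3 * g 1 + 3 * C 3 = 0" and ag4: "a 4 * g 2 + 4 * C 4 = 0"
    using ag[of 1] ag[of 2] by (simp_all add: eval_nat_numeral)
  have g1: "2 * (g 1 + (a 3 - a 2 + 24 * \<beta>)) = a 2"
    using G(1)[of 0] unfolding e2[symmetric] by (simp add: eval_nat_numeral mult.commute)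
  have g2: "3 * (g 2 + (a 4 - a 3 + 48 * \<beta>)) = a 3"
    using G(1)[of 1] unfolding e3[symmetric] by (simp add: eval_nat_numeral mult.commute)
  have "a 3 * \<beta> = - 3 * K" using k0 k1 C3 ag3 g1 by algebra
  moreover have "a 4 * \<beta> = - 5 * K" using k1 k2 C4 ag4 g2 by algebra
  \<comment> \<open>After multiplying \<open>k1\<close> by \<open>\<beta>\<close>, both sides
    contain \<open>-15 * K\<close>, which leaves \<open>180 * \<beta>\<^sup>2 = 0\<close>.\<close>
  ultimately have "\<beta> = 0" using k1 by algebra
  with \<open>a 3 * \<beta> = - 3 * K\<close> K_nonzero show False by simp
qed

end

end

section \<open>Identification with continuous dual Hahn polynomials\<close>

lemma monic_cdHahn_form:
  fixes \<beta> c5 \<kappa> \<mu> :: complex and P :: "nat \<Rightarrow> complex poly" and B C :: "nat \<Rightarrow> complex"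
  assumes \<beta>: "\<beta> \<noteq> 0" and rec: "recurrence_coeffs P B C"
    and B: "\<And>n. B n + c5\<^sup>2 / (16 * \<beta>) =
      - 8 * \<beta> * (of_nat n)\<^sup>2 + 2 * \<kappa> * of_nat n + \<kappa> + \<mu> + \<beta>"
    and C: "\<And>n. C (Suc n) = of_nat (Suc n) * (- 4 * \<beta> * (of_nat (Suc n))\<^sup>2
      + (\<kappa> + 4 * \<beta>) * of_nat (Suc n) + \<mu>) * (\<kappa> - 4 * \<beta> * of_nat n)"
  shows "\<exists>a b. cdHahn_admissible a b (1/2) \<and>
            (\<forall>n z. poly (P n) z =
               (- 4 * \<beta>) ^ n * poly (cdHahn a b (1/2) n)
                 (- (1 / (4 * \<beta>)) * (z + c5\<^sup>2 / (16 * \<beta>))))"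
proof -
  \<comment> \<open>\<open>S\<close> and \<open>Q\<close> are the sum and product of the sought
    parameters. They are chosen so that the quadratic factor of \<open>C (Suc n)\<close> becomes
    \<open>- 4 * \<beta> * (n + a + 1/2) * (n + b + 1/2)\<close> and the linear one
    \<open>- 4 * \<beta> * (n + a + b)\<close>.\<close>
  define S where "S = - \<kappa> / (4 * \<beta>)"
  define Q where "Q = - \<mu> / (4 * \<beta>) + S / 2 - 1 / 4"
  define a where "a = (S + csqrt (S\<^sup>2 - 4 * Q)) / 2"
  define b where "b = (S - csqrt (S\<^sup>2 - 4 * Q)) / 2"
  have ab: "a + b = S" "a * b = Q"
  proof -
    show "a + b = S" by (simp add: a_def b_def field_simps)
    have "4 * (a * b) = S\<^sup>2 - (csqrt (S\<^sup>2 - 4 * Q))\<^sup>2"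
      by (simp add: a_def b_def power2_eq_square field_simps)
    then show "a * b = Q" by simp
  qed
  have \<kappa>: "\<kappa> = - 4 * \<beta> * (a + b)" and \<mu>: "\<mu> = - 4 * \<beta> * (a * b - (a + b) / 2 + 1 / 4)"
    unfolding ab using \<beta> by (simp_all add: S_def Q_def field_simps)
  have HB: "B n + c5\<^sup>2 / (16 * \<beta>) = - 4 * \<beta> * cdHahn_B a b (1/2) n" for n
    unfolding B cdHahn_B_def \<kappa> \<mu> by (simp add: power2_eq_square field_simps)
  have HC: "C (Suc n) = 16 * \<beta>\<^sup>2 * cdHahn_C a b (1/2) (Suc n)" for n
    unfolding C cdHahn_C.simps \<kappa> \<mu> by (simp add: power2_eq_square field_simps)
  \<comment> \<open>Each excluded parameter value would annul one factor of some
    \<open>cdHahn_C\<close>, so admissibility follows from the nonvanishing of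
    \<open>C\<close>.\<close>
  have nz: "cdHahn_C a b (1/2) (Suc n) \<noteq> 0" for n
    using rec HC[of n] unfolding recurrence_coeffs_def by (metis One_nat_def le_add1 mult_zero_right plus_1_eq_Suc)
  have adm: "cdHahn_admissible a b (1/2)"
    unfolding cdHahn_admissible_def
  proof (intro conjI notI)
    assume "- a - b \<in> \<nat>"
    then obtain n where n: "- a - b = of_nat n" by (auto elim: Nats_cases)
    have "of_nat n + a + b = 0" unfolding n[symmetric] by simp
    with nz[of n] show False by simp
  next
    assume "- a - 1/2 \<in> \<nat>"
    then obtain n where n: "- a - 1/2 = of_nat n" by (auto elim: Nats_cases)
    have "of_nat n + a + 1/2 = 0" unfolding n[symmetric] by simp
    with nz[of n] show False by simp
  next
    assume "- b - 1/2 \<in> \<nat>"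
    then obtain n where n: "- b - 1/2 = of_nat n" by (auto elim: Nats_cases)
    have "of_nat n + b + 1/2 = 0" unfolding n[symmetric] by simp
    with nz[of n] show False by simp
  qed
  have P: "P 0 = 1" "P (Suc n) = [:- B n, 1:] * P n - smult (C n) (prev P n)" for n
    using rec by (auto simp: recurrence_coeffs_def)
  have "poly (P n) z = (- 4 * \<beta>) ^ n * poly (cdHahn a b (1/2) n)
                 (- (1 / (4 * \<beta>)) * (z + c5\<^sup>2 / (16 * \<beta>)))" for n z
  proof -
    define y where "y = - (1 / (4 * \<beta>)) * (z + c5\<^sup>2 / (16 * \<beta>))"
    \<comment> \<open>In the variable \<open>y\<close> each linear factor gains
      \<open>- 4 * \<beta>\<close>, matching the factor \<open>16 * \<beta>\<^sup>2\<close> in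
      \<open>HC\<close>; hence the power in the claim.\<close>
    have zB: "z - B n = - 4 * \<beta> * (y - cdHahn_B a b (1/2) n)" for n
    proof -
      have "- 4 * \<beta> * y = z + c5\<^sup>2 / (16 * \<beta>)" using \<beta> by (simp add: y_def)
      then have "z - B n = - 4 * \<beta> * y - (B n + c5\<^sup>2 / (16 * \<beta>))" by simp
      then show ?thesis unfolding HB by (simp only: right_diff_distrib)
    qed
    have "poly (P n) z = (- 4 * \<beta>) ^ n * poly (cdHahn a b (1/2) n) y"
    proof (induction n rule: induct_nat_012)
      case 0
      show ?case by (simp add: P)
    next
      case 1
      show ?case using zB[of 0] by (simp add: P prev_def)
    next
      case (ge2 n)
      have "poly (P (Suc (Suc n))) z = (z - B (Suc n)) * poly (P (Suc n)) z - C (Suc n) * poly (P n) z"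
        by (simp add: P(2)[of "Suc n"] prev_def algebra_simps)
      also have "\<dots> = (- 4 * \<beta>) ^ Suc (Suc n) * ((y - cdHahn_B a b (1/2) (Suc n)) * poly (cdHahn a b (1/2) (Suc n)) y
          - cdHahn_C a b (1/2) (Suc n) * poly (cdHahn a b (1/2) n) y)"
        unfolding ge2 zB HC by (simp add: power2_eq_square algebra_simps del: cdHahn_C.simps)
      also have "\<dots> = (- 4 * \<beta>) ^ Suc (Suc n) * poly (cdHahn a b (1/2) (Suc (Suc n))) y"
        by (simp add: algebra_simps del: cdHahn_C.simps power_Suc)
      finally show ?case .
    qed
    then show ?thesis by (simp only: y_def)
  qed
  with adm show ?thesis by blast
qed

section \<open>Application to the orthogonal sequence\<close>

theorem corollary4p1:
  fixes \<beta> c5 c :: complex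
    and u :: "complex poly \<Rightarrow> complex"
    and P :: "nat \<Rightarrow> complex poly"
    and B C b_seq c_seq :: "nat \<Rightarrow> complex"
  assumes "(\<beta>, c5) \<noteq> (0, 0)"
    and "u \<in> algebraic_dual"
    and "is_monic_OPS u P"
    and "recurrence_coeffs P B C"
    and "\<And>n. [:c, 1:] * Dx (quadratic_lattice \<beta> c5) (P n) =
           smult (b_seq n) (Sx (quadratic_lattice \<beta> c5) (P n))
           + smult (c_seq n) (Sx (quadratic_lattice \<beta> c5) (prev P n))"
    and "\<And>n. n \<ge> 1 \<Longrightarrow> c_seq n \<noteq> 0"
    and "2 * (C 2 + (B 0 - B 1) * c) = (B 1 - 5 * \<beta>)\<^sup>2 - (B 0 - 5 * \<beta>)\<^sup>2"
  shows "(\<exists>a b. cdHahn_admissible a b (1/2) \<and>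
            (\<forall>n z. poly (P n) z =
               (- 4 * \<beta>) ^ n * poly (cdHahn a b (1/2) n)
                 (- (1 / (4 * \<beta>)) * (z + c5\<^sup>2 / (16 * \<beta>)))))
       \<or> (\<exists>d e. - d \<notin> \<nat> \<and>
            e = - 1 + 1 / (1 + d) * (1 - c5\<^sup>2 / (64 * \<beta>\<^sup>2)) \<and>
            cdHahn_admissible (d - 1/2) (e - 1/2) (1/2) \<and>
            (\<forall>n z. poly (P n) z =
               (- 4 * \<beta>) ^ n * poly (cdHahn (d - 1/2) (e - 1/2) (1/2) n)
                 (- (1 / (4 * \<beta>)) * (z + 2 * \<beta> + c5\<^sup>2 / (16 * \<beta>)))))"
proof -
  let ?x = "quadratic_lattice \<beta> c5"
  define s where "s n = Sx ?x (P n)" for n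
  define d where "d n = Dx ?x (P n)" for n
  \<comment> \<open>The entries at 0 only multiply \<open>prev P 0 = 0\<close> or its image under
    \<open>Sx\<close>. Setting them to 0 keeps the relations true when \<open>prev P n\<close> is
    replaced by \<open>P (n - 1)\<close> with truncated subtraction.\<close>
  define a where "a = c_seq(0 := 0)"
  define C' where "C' = C(0 := 0)"
  define e where "e n = B n + c - \<beta>" for n
  define K where "K = c5\<^sup>2 / 4 - 4 * \<beta> * c"
  have P: "P 0 = 1" "P (Suc n) = [:- B n, 1:] * P n - smult (C n) (prev P n)" "n \<ge> 1 \<Longrightarrow> C n \<noteq> 0" for n
    using assms(4) by (auto simp: recurrence_coeffs_def)
  have Suc': "P (Suc n) = [:- B n, 1:] * P n - smult (C' n) (P (n - 1))" for n
    by (cases n) (simp_all add: P(2) prev_def C'_def)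
  interpret structure_relation s d \<beta> c K a b_seq e C'
  proof
    show "s 0 = 1" "d 0 = 0"
      by (simp_all add: s_def d_def P Dx_Sx_one[OF assms(1)])
    show "d (Suc n) = s n + [:c - e n, 1:] * d n - smult (C' n) (d (n - 1))"
      "s (Suc n) = [:c - e n, 1:] * s n + [:4 * \<beta> * c + K, 4 * \<beta>:] * d n - smult (C' n) (s (n - 1))" for n
      unfolding s_def d_def Suc' Dx_Sx_recurrence[OF assms(1)] by (simp_all add: e_def K_def)
    show "[:c, 1:] * d n = smult (b_seq n) (s n) + smult (a n) (s (n - 1))" for n
    proof (cases n)
      case 0
      have "Sx ?x 0 = 0" by (rule Sx_eqI[OF assms(1)]) simp
      then show ?thesis using assms(5)[of 0] 0 by (simp add: s_def d_def a_def prev_def)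
    next
      case (Suc m)
      then show ?thesis using assms(5)[of n] by (simp add: s_def d_def a_def prev_def)
    qed
    show "a n \<noteq> 0" "C' n \<noteq> 0" if "n \<ge> 1" for n
      using that assms(6) P(3) by (auto simp: a_def C'_def)
  qed (simp_all add: a_def C'_def)
  have K: "K = 0"
    using no_solution_of_K_nonzero by blast
  \<comment> \<open>For \<open>\<beta> = 0\<close> the equation \<open>K = 0\<close> would force
    \<open>c5 = 0\<close>.\<close>
  have \<beta>: "\<beta> \<noteq> 0"
    using K assms(1) by (auto simp: K_def)
  have c: "c = c5\<^sup>2 / (16 * \<beta>)"
    using K \<beta> by (simp add: K_def field_simps)
  obtain \<kappa> \<mu> where a: "\<And>n. a n = of_nat n * (- 4 * \<beta> * (of_nat n)\<^sup>2 + (\<kappa> + 4 * \<beta>) * of_nat n + \<mu>)"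
    and C: "\<And>n. C' n = a n * (\<kappa> + 4 * \<beta> - 4 * \<beta> * of_nat n)"
    using solution_of_K_zero[OF K] by blast
  have "\<exists>a b. cdHahn_admissible a b (1/2) \<and>
            (\<forall>n z. poly (P n) z =
               (- 4 * \<beta>) ^ n * poly (cdHahn a b (1/2) n)
                 (- (1 / (4 * \<beta>)) * (z + c5\<^sup>2 / (16 * \<beta>))))"
  proof (rule monic_cdHahn_form[OF \<beta> assms(4), where \<kappa> = \<kappa> and \<mu> = \<mu>])
    fix n
    \<comment> \<open>Since \<open>K = 0\<close> identifies \<open>c\<close> with the shift
      \<open>c5\<^sup>2 / (16 * \<beta>)\<close>, the shifted \<open>B n\<close> is
      \<open>e n + \<beta>\<close>, and \<open>e_eq\<close> evaluates it from the first difference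
      of the cubic \<open>a\<close>.\<close>
    have "B n + c = e n + \<beta>" by (simp add: e_def)
    then show "B n + c5\<^sup>2 / (16 * \<beta>) = - 8 * \<beta> * (of_nat n)\<^sup>2 + 2 * \<kappa> * of_nat n + \<kappa> + \<mu> + \<beta>"
      unfolding c[symmetric] e_eq a by (simp add: power2_eq_square algebra_simps)
    show "C (Suc n) = of_nat (Suc n) * (- 4 * \<beta> * (of_nat (Suc n))\<^sup>2
      + (\<kappa> + 4 * \<beta>) * of_nat (Suc n) + \<mu>) * (\<kappa> - 4 * \<beta> * of_nat n)"
      using C[of "Suc n"] unfolding a by (simp add: C'_def algebra_simps)
  qed
  then show ?thesis ..
qed

end
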